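(* Let $(X,d)$ be a compact metric space, let $f_n:X\to X$, $n\ge0$, be continuous maps such that $\{f_n\}_{n=0}^\infty$ is equi-continuous in $X$, let $A=(a_{ij})_{N\times N}$ be a transition matrix, let $\{V_{i,n}\}_{n=0}^\infty$, $1\le i\le N$, be sequences of nonempty closed subsets of $X$, and let $V_i$, $1\le i\le N$, be disjoint closed subsets of $X$ with $V_{i,n}\subset V_i$ for all $1\le i\le N$, $n\ge0$. Assume that $V_\alpha^{m,n}:=\bigcap_{k=0}^{m}f_n^{-k}(V_{a_k,n+k})\ne\emptyset$ for all $m,n\ge0$ and all $\alpha=(a_0,a_1,\dots)\in\Sigma_N^+(A)$. Then for every $n\ge0$ there exists a nonempty compact subset $\mathcal C_n\subset\bigcup_{i=1}^N\langle V_{i,n}\rangle$ of $\mathcal K(X)$ with $\bar f_n(\mathcal C_n)\subset\mathcal C_{n+1}$ such that the invariant subsystem of the induced set-valued system $A_{n+1}=\bar f_n(A_n)$ on $\{\mathcal C_n\}_{n=0}^\infty$ is topologically equi-semiconjugate to $(\Sigma_N^+(A),\sigma_A)$. Consequently, $h(\bar f_{0,\infty},\mathcal C_0)\ge\log\rho(A)$.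
   Context: For a sequence of maps $g_n$ of a space $Z$ into itself, $g_i^n:=g_{i+n-1}\circ\cdots\circ g_i$ for $n\ge1$, $g_i^0$ is the identity, and $g_i^{-n}:=(g_i^n)^{-1}$ (preimage). A sequence of maps $h_n:W_n\to Y$ between metric spaces, $W_n$ subsets of a common metric space, is equi-continuous in $\{W_n\}$ if for every $\epsilon>0$ there is $\delta>0$, independent of $n$, such that for all $n\ge0$ points of $W_n$ at distance less than $\delta$ have $h_n$-images at distance less than $\epsilon$; "in $X$" means $W_n=X$ for all $n$. $\mathcal K(X)$ is the set of all nonempty compact subsets of $X$ with the Hausdorff metric $\mathcal H_d(B,C):=\max\{\sup_{b\in B}d(b,C),\sup_{c\in C}d(c,B)\}$ (a compact metric space). For nonempty $K\subset X$, $\langle K\rangle:=\{B\in\mathcal K(X):B\subset K\}$; $\bar f_n:\mathcal K(X)\to\mathcal K(X)$ is $\bar f_n(B):=f_n(B)$; $\bar f_{0,\infty}:=\{\bar f_n\}_{n=0}^\infty$. In $\bar f_n(\mathcal C_n)$ the map $\bar f_n$ is applied elementwise: $\bar f_n(\mathcal C_n)=\{\bar f_n(B):B\in\mathcal C_n\}$. A transition matrix is a matrix $A=(a_{ij})_{N\times N}$, $N\ge2$, with $a_{ij}\in\{0,1\}$, $\sum_{j=1}^N a_{ij}\ge1$ for all $i$ and $\sum_{i=1}^N a_{ij}\ge1$ for all $j$. $\Sigma_N^+(A):=\{s=(s_0,s_1,\dots):1\le s_j\le N,\ a_{s_js_{j+1}}=1,\ j\ge0\}$, with metric $\hat\rho(\alpha,\beta):=\sum_{i=0}^\infty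 \hat d(a_i,b_i)/2^i$ for $\alpha=(a_0,a_1,\dots)$, $\beta=(b_0,b_1,\dots)$, where $\hat d(a,b)=0$ if $a=b$ and $1$ otherwise. $\sigma_A:\Sigma_N^+(A)\to\Sigma_N^+(A)$, $\sigma_A((s_0,s_1,s_2,\dots)):=(s_1,s_2,\dots)$. $\rho(A):=\lim_{n\to\infty}\|A^n\|^{1/n}$, where $\|B\|$ denotes the sum of all entries of $B$. For subsets $\mathcal C_n\subset\mathcal K(X)$ with $\bar f_n(\mathcal C_n)\subset\mathcal C_{n+1}$ for all $n\ge0$, the set-valued system restricted to $\{\mathcal C_n\}$ is called its invariant subsystem on $\{\mathcal C_n\}_{n=0}^\infty$. It is topologically equi-semiconjugate to $(\Sigma_N^+(A),\sigma_A)$ if there are surjective maps $h_n:\mathcal C_n\to\Sigma_N^+(A)$, $n\ge0$, with $\{h_n\}$ equi-continuous in $\{\mathcal C_n\}$, such that $h_{n+1}\circ\bar f_n=\sigma_A\circ h_n$ on $\mathcal C_n$ for all $n\ge0$. Topological entropy: for a compact metric space $Z$, maps $g_n:Z\to Z$ and nonempty $Y\subset Z$, $h(g_{0,\infty},Y):=\sup_{\mathcal A}\limsup_{n\to\infty}\frac1n\log\mathcal N(\mathcal A_0^n|_Y)$, the supremum over open covers $\mathcal A$ of $Z$, where $\mathcal A_0^n:=\{\bigcap_{j=0}^{n-1}g_0^{-j}(A_j):A_j\in\mathcal A\}$, $\mathcal B|_Y:=\{B\cap Y:B\in\mathcal B\}$, and $\mathcal N(\cdot)$ is the minimal cardinality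 of a subcover. *)

theory Defs
  imports "HOL-Analysis.Analysis"
begin

section \<open>Non-autonomous iteration\<close>

text \<open>\<open>iter_from g i n\<close> is \<open>g\<^sub>i\<^sup>n = g\<^bsub>i+n-1\<^esub> \<circ> \<dots> \<circ> g\<^sub>i\<close>, and \<open>iter_preimage Z g i n S\<close> is
  \<open>g\<^sub>i\<^sup>-\<^sup>n(S)\<close>, the preimage being taken in the space \<open>Z\<close>.\<close>

primrec iter_from :: "(nat \<Rightarrow> 'a \<Rightarrow> 'a) \<Rightarrow> nat \<Rightarrow> nat \<Rightarrow> 'a \<Rightarrow> 'a" where
  "iter_from g i 0 = id"
| "iter_from g i (Suc n) = g (i + n) \<circ> iter_from g i n"

definition iter_preimage :: "'a set \<Rightarrow> (nat \<Rightarrow> 'a \<Rightarrow> 'a) \<Rightarrow> nat \<Rightarrow> nat \<Rightarrow> 'a set \<Rightarrow> 'a set" where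
  "iter_preimage Z g i n S = {z \<in> Z. iter_from g i n z \<in> S}"

definition equicontinuous_in ::
  "('a \<Rightarrow> 'a \<Rightarrow> real) \<Rightarrow> ('b \<Rightarrow> 'b \<Rightarrow> real) \<Rightarrow> (nat \<Rightarrow> 'a set) \<Rightarrow> (nat \<Rightarrow> 'a \<Rightarrow> 'b) \<Rightarrow> bool" where
  "equicontinuous_in d d' W h \<longleftrightarrow>
     (\<forall>\<epsilon>>0. \<exists>\<delta>>0. \<forall>n. \<forall>x\<in>W n. \<forall>y\<in>W n. d x y < \<delta> \<longrightarrow> d' (h n x) (h n y) < \<epsilon>)"


section \<open>The hyperspace of nonempty compact subsets\<close>

definition hyperspace :: "'a set \<Rightarrow> ('a \<Rightarrow> 'a \<Rightarrow> real) \<Rightarrow> 'a set set" where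
  "hyperspace X d = {B. B \<noteq> {} \<and> compactin (Metric_space.mtopology X d) B}"

definition point_set_dist :: "('a \<Rightarrow> 'a \<Rightarrow> real) \<Rightarrow> 'a \<Rightarrow> 'a set \<Rightarrow> real" where
  "point_set_dist d x B = (INF b\<in>B. d x b)"

text \<open>The locale \<^locale>\<open>Metric_space\<close> requires its distance to be nonnegative on the whole type,
  whereas suprema of empty or unbounded sets of reals are unspecified; hence the value 0
  outside the hyperspace.\<close>

definition hausdorff_metric :: "'a set \<Rightarrow> ('a \<Rightarrow> 'a \<Rightarrow> real) \<Rightarrow> 'a set \<Rightarrow> 'a set \<Rightarrow> real" where
  "hausdorff_metric X d B C =
     (if B \<in> hyperspace X d \<and> C \<in> hyperspace X d
      then max (SUP b\<in>B. point_set_dist d b C) (SUP c\<in>C. point_set_dist d c B)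
      else 0)"

abbreviation hyperspace_topology :: "'a set \<Rightarrow> ('a \<Rightarrow> 'a \<Rightarrow> real) \<Rightarrow> 'a set topology" where
  "hyperspace_topology X d \<equiv> Metric_space.mtopology (hyperspace X d) (hausdorff_metric X d)"

text \<open>\<open>compact_subsets X d K\<close> is \<open>\<langle>K\<rangle>\<close>.\<close>

definition compact_subsets :: "'a set \<Rightarrow> ('a \<Rightarrow> 'a \<Rightarrow> real) \<Rightarrow> 'a set \<Rightarrow> 'a set set" where
  "compact_subsets X d K = {B \<in> hyperspace X d. B \<subseteq> K}"

definition induced_maps :: "(nat \<Rightarrow> 'a \<Rightarrow> 'a) \<Rightarrow> nat \<Rightarrow> 'a set \<Rightarrow> 'a set" where
  "induced_maps f n B = f n ` B"


section \<open>One-sided subshifts of finite type\<close>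

text \<open>The symbols \<open>1, \<dots>, N\<close> are the elements of a finite type \<open>'n\<close> with \<open>N = CARD('n)\<close>.\<close>

definition transition_matrix :: "real ^ 'n ^ 'n \<Rightarrow> bool" where
  "transition_matrix A \<longleftrightarrow>
     CARD('n) \<ge> 2 \<and>
     (\<forall>i j. A $ i $ j \<in> {0, 1}) \<and>
     (\<forall>i. (\<Sum>j\<in>UNIV. A $ i $ j) \<ge> 1) \<and>
     (\<forall>j. (\<Sum>i\<in>UNIV. A $ i $ j) \<ge> 1)"

definition shift_space :: "real ^ 'n ^ 'n \<Rightarrow> (nat \<Rightarrow> 'n) set" where
  "shift_space A = {s. \<forall>j. A $ s j $ s (Suc j) = 1}"

definition shift_dist :: "(nat \<Rightarrow> 'n) \<Rightarrow> (nat \<Rightarrow> 'n) \<Rightarrow> real" where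
  "shift_dist \<alpha> \<beta> = (\<Sum>i. (if \<alpha> i = \<beta> i then 0 else 1) / 2 ^ i)"

definition shift_map :: "(nat \<Rightarrow> 'n) \<Rightarrow> nat \<Rightarrow> 'n" where
  "shift_map s = (\<lambda>j. s (Suc j))"

definition matrix_norm_sum :: "real ^ 'n ^ 'n \<Rightarrow> real" where
  "matrix_norm_sum B = (\<Sum>i\<in>UNIV. \<Sum>j\<in>UNIV. B $ i $ j)"

definition matrix_power :: "real ^ 'n ^ 'n \<Rightarrow> nat \<Rightarrow> real ^ 'n ^ 'n" where
  "matrix_power A n = (((**) A) ^^ n) (mat 1)"

definition matrix_rho :: "real ^ 'n ^ 'n \<Rightarrow> real" where
  "matrix_rho A = lim (\<lambda>n. matrix_norm_sum (matrix_power A n) powr (1 / real n))"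


section \<open>Equi-semiconjugacy\<close>

text \<open>The sequence \<open>g n : W n \<rightarrow> W (Suc n)\<close>, with distance \<open>d\<close>, is equi-semiconjugate to the
  single map \<open>\<sigma>\<close> on \<open>S\<close>, with distance \<open>d'\<close>.\<close>

definition equi_semiconjugate ::
  "('a \<Rightarrow> 'a \<Rightarrow> real) \<Rightarrow> (nat \<Rightarrow> 'a set) \<Rightarrow> (nat \<Rightarrow> 'a \<Rightarrow> 'a) \<Rightarrow>
   ('b \<Rightarrow> 'b \<Rightarrow> real) \<Rightarrow> 'b set \<Rightarrow> ('b \<Rightarrow> 'b) \<Rightarrow> bool" where
  "equi_semiconjugate d W g d' S \<sigma> \<longleftrightarrow>
     (\<exists>h :: nat \<Rightarrow> 'a \<Rightarrow> 'b.
        (\<forall>n. h n ` W n = S) \<and>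
        equicontinuous_in d d' W h \<and>
        (\<forall>n. \<forall>x\<in>W n. h (Suc n) (g n x) = \<sigma> (h n x)))"


section \<open>Topological entropy\<close>

definition open_cover :: "'a topology \<Rightarrow> 'a set set \<Rightarrow> bool" where
  "open_cover T \<A> \<longleftrightarrow> (\<forall>U\<in>\<A>. openin T U) \<and> \<Union>\<A> = topspace T"

definition refined_cover :: "'a set \<Rightarrow> (nat \<Rightarrow> 'a \<Rightarrow> 'a) \<Rightarrow> 'a set set \<Rightarrow> nat \<Rightarrow> 'a set set" where
  "refined_cover Z g \<A> n =
     {Z \<inter> (\<Inter>j<n. iter_preimage Z g 0 j (U j)) | U. \<forall>j<n. U j \<in> \<A>}"

definition restrict_cover :: "'a set set \<Rightarrow> 'a set \<Rightarrow> 'a set set" where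
  "restrict_cover \<B> Y = (\<lambda>B. B \<inter> Y) ` \<B>"

text \<open>Over a compact space finite subcovers of the covers below always exist, so the minimum
  is attained.\<close>

definition min_subcover_card :: "'a set set \<Rightarrow> 'a set \<Rightarrow> nat" where
  "min_subcover_card \<B> Y = (LEAST k. \<exists>\<C>\<subseteq>\<B>. finite \<C> \<and> \<Union>\<C> = Y \<and> card \<C> = k)"

definition top_entropy :: "'a topology \<Rightarrow> (nat \<Rightarrow> 'a \<Rightarrow> 'a) \<Rightarrow> 'a set \<Rightarrow> ereal" where
  "top_entropy T g Y =
     (SUP \<A>\<in>{\<A>. open_cover T \<A>}.
        limsup (\<lambda>n. ereal (1 / real n *
          ln (real (min_subcover_card (restrict_cover (refined_cover (topspace T) g \<A> n) Y) Y)))))"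

end

theory Submission
  imports Defs
begin

text \<open>Let \<open>K\<^sub>n(\<alpha>)\<close> be the set of points whose orbit from time \<open>n\<close> on follows \<open>\<alpha>\<close>; it is compact and,
  by the itinerary hypothesis, nonempty. Take for \<open>\<C>\<^sub>n\<close> all nonempty compact subsets of the sets
  \<open>K\<^sub>n(\<alpha>)\<close>, \<open>\<alpha> \<in> \<Sigma>(A)\<close>, and for the semiconjugacy the map sending \<open>B\<close> to the unique \<open>\<alpha>\<close> with
  \<open>B \<subseteq> K\<^sub>n(\<alpha>)\<close>. Since the \<open>V\<^sub>i\<close> are a positive distance \<open>\<eta>\<close> apart, two Hausdorff-close members of
  \<open>\<C>\<^sub>n\<close> have codes with a long common prefix. In a cover of the hyperspace by balls of radius \<open>\<eta>/2\<close>,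
  each element of the refinement of order \<open>n\<close> sees only one word of length \<open>n\<close>, so a subcover of
  \<open>\<C>\<^sub>0\<close> has at least as many elements as there are admissible words of length \<open>n\<close>, namely the sum of
  the entries of \<open>A\<close> to the power \<open>n - 1\<close>.\<close>


section \<open>Compactness of the hyperspace\<close>

lemma (in Metric_space) point_set_dist_le:
  assumes "c \<in> C" shows "point_set_dist d b C \<le> d b c"
  unfolding point_set_dist_def using assms by (auto intro!: cINF_lower bdd_belowI2[of _ 0])

lemma (in Metric_space) hyperspaceD:
  assumes "B \<in> hyperspace M d"
  shows "B \<noteq> {}" "B \<subseteq> M" "compactin mtopology B" "closedin mtopology B"
proof -
  show "B \<noteq> {}" and *: "compactin mtopology B" using assms by (auto simp: hyperspace_def)
  then show "B \<subseteq> M" using compactin_subset_topspace by fastforce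
  show "closedin mtopology B" using * Hausdorff_space_mtopology compactin_imp_closedin by blast
qed

text \<open>Together with \<open>hausdorff_metric_lessD\<close> this trades suprema and infima for
  nearest-point estimates; the later estimates go through these two.\<close>

lemma (in Metric_space) hausdorff_metric_le:
  assumes "B \<in> hyperspace M d" "C \<in> hyperspace M d"
    and "\<And>b. b \<in> B \<Longrightarrow> \<exists>c\<in>C. d b c \<le> e" "\<And>c. c \<in> C \<Longrightarrow> \<exists>b\<in>B. d c b \<le> e"
  shows "hausdorff_metric M d B C \<le> e"
proof -
  have "point_set_dist d b C \<le> e" if "b \<in> B" for b
    using assms(3)[OF that] point_set_dist_le order_trans by blast
  moreover have "point_set_dist d c B \<le> e" if "c \<in> C" for c
    using assms(4)[OF that] point_set_dist_le order_trans by blast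
  ultimately show ?thesis
    using assms(1,2) hyperspaceD(1)[OF assms(1)] hyperspaceD(1)[OF assms(2)]
    by (auto simp: hausdorff_metric_def intro!: cSUP_least)
qed

lemma hausdorff_metric_commute: "hausdorff_metric M d B C = hausdorff_metric M d C B"
  by (auto simp: hausdorff_metric_def max.commute)

text \<open>A real supremum is known to be an upper bound only for a bounded set; here compactness
  of \<open>B\<close> gives boundedness. One fixed point \<open>c\<close> of \<open>C\<close>
  suffices, since its distance to \<open>b\<close> dominates the distance from \<open>b\<close> to
  \<open>C\<close>.\<close>

lemma (in Metric_space) bdd_above_point_set_dist:
  assumes "B \<in> hyperspace M d" "C \<in> hyperspace M d"
  shows "bdd_above ((\<lambda>b. point_set_dist d b C) ` B)"
proof -
  obtain c where c: "c \<in> C" "c \<in> M" using hyperspaceD[OF assms(2)] by blast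
  obtain x r where "B \<subseteq> mcball x r"
    using hyperspaceD(3)[OF assms(1)] compactin_imp_mbounded mbounded_def by meson
  then have "point_set_dist d b C \<le> r + d x c" if "b \<in> B" for b
    using that c triangle[of b x c] commute[of b x] point_set_dist_le[OF c(1), of b]
    by (smt (verit) in_mcball subsetD)
  then show ?thesis by (rule bdd_aboveI2)
qed

text \<open>Only one of the two suprema is used; the other direction follows by symmetry. Strictness
  is what lets the infimum be replaced by an actual point.\<close>

lemma (in Metric_space) hausdorff_metric_lessD:
  assumes "B \<in> hyperspace M d" "C \<in> hyperspace M d" "hausdorff_metric M d B C < e" "b \<in> B"
  shows "\<exists>c\<in>C. d b c < e"
proof -
  have "point_set_dist d b C \<le> (SUP b\<in>B. point_set_dist d b C)"
    by (rule cSUP_upper[OF assms(4) bdd_above_point_set_dist[OF assms(1,2)]])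
  also have "\<dots> < e" using assms by (simp add: hausdorff_metric_def)
  finally have "(INF c\<in>C. d b c) < e" by (simp add: point_set_dist_def)
  moreover have "bdd_below (d b ` C)" by (rule bdd_belowI2[of _ 0]) simp
  ultimately show ?thesis using hyperspaceD(1)[OF assms(2)] by (simp add: cINF_less_iff)
qed

lemma (in Metric_space) hausdorff_metric_nonneg: "0 \<le> hausdorff_metric M d B C"
proof (cases "B \<in> hyperspace M d \<and> C \<in> hyperspace M d")
  case True
  then obtain b where b: "b \<in> B" using hyperspaceD by blast
  show ?thesis
  proof (rule ccontr)
    assume "\<not> ?thesis"
    then obtain c where "d b c < 0" using hausdorff_metric_lessD[of B C 0 b] True b by auto
    then show False using nonneg[of b c] by linarith
  qed
qed (auto simp: hausdorff_metric_def)

text \<open>Distance zero puts each point of \<open>B\<close> into the closure of \<open>C\<close>,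
  and compact sets are closed here.\<close>

lemma (in Metric_space) hausdorff_metric_eq_0_imp_subset:
  assumes "B \<in> hyperspace M d" "C \<in> hyperspace M d" "hausdorff_metric M d B C = 0"
  shows "B \<subseteq> C"
proof
  fix b assume b: "b \<in> B"
  have "\<exists>c\<in>C. d b c < r" if "r > 0" for r
    using hausdorff_metric_lessD[OF assms(1,2) _ b] that assms(3) by simp
  then have "b \<in> mtopology closure_of C"
    using b hyperspaceD(2)[OF assms(1)] hyperspaceD(2)[OF assms(2)]
    by (auto simp: metric_closure_of subset_iff)
  then show "b \<in> C" using hyperspaceD(4)[OF assms(2)] by (simp add: closure_of_closedin)
qed

lemma (in Metric_space) hausdorff_metric_triangle:
  assumes BCD: "B \<in> hyperspace M d" "C \<in> hyperspace M d" "D \<in> hyperspace M d"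
  shows "hausdorff_metric M d B D \<le> hausdorff_metric M d B C + hausdorff_metric M d C D"
proof (rule field_le_epsilon)
  fix e :: real assume e: "e > 0"
  let ?H = "hausdorff_metric M d"
  \<comment> \<open>The directed estimate has arbitrary ends \<open>B'\<close> and
    \<open>D'\<close>, so it serves from \<open>B\<close> to \<open>D\<close> and back. Each leg
    costs \<open>e/2\<close> because a strict bound is needed before a point can be chosen.\<close>
  have half: "\<exists>z\<in>D'. d x z \<le> ?H B' C + ?H C D' + e"
    if BDx: "B' \<in> hyperspace M d" "D' \<in> hyperspace M d" "x \<in> B'" for B' D' x
  proof -
    obtain y where y: "y \<in> C" "d x y < ?H B' C + e/2"
      using hausdorff_metric_lessD[OF BDx(1) BCD(2) _ BDx(3), of "?H B' C + e/2"] e by auto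
    obtain z where z: "z \<in> D'" "d y z < ?H C D' + e/2"
      using hausdorff_metric_lessD[OF BCD(2) BDx(2) _ y(1), of "?H C D' + e/2"] e by auto
    have "d x z \<le> d x y + d y z"
      using BDx y z hyperspaceD(2) BCD by (meson subsetD triangle)
    then have "d x z \<le> ?H B' C + ?H C D' + e" using y(2) z(2) by linarith
    then show ?thesis using z(1) by blast
  qed
  show "?H B D \<le> ?H B C + ?H C D + e"
    using half[OF BCD(1,3)] half[OF BCD(3,1)]
    by (intro hausdorff_metric_le BCD)
      (auto simp: hausdorff_metric_commute[of _ _ D C] hausdorff_metric_commute[of _ _ C B] add.commute)
qed

lemma (in Metric_space) Metric_space_hausdorff:
  "Metric_space (hyperspace M d) (hausdorff_metric M d)"
proof
  show "0 \<le> hausdorff_metric M d B C" for B C by (rule hausdorff_metric_nonneg)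
  show "hausdorff_metric M d B C = hausdorff_metric M d C B" for B C
    by (rule hausdorff_metric_commute)
  fix B C assume BC: "B \<in> hyperspace M d" "C \<in> hyperspace M d"
  show "hausdorff_metric M d B C = 0 \<longleftrightarrow> B = C"
  proof
    assume "hausdorff_metric M d B C = 0"
    then show "B = C"
      using hausdorff_metric_eq_0_imp_subset BC hausdorff_metric_commute[of M d B C] by force
  next
    assume "B = C"
    then have "hausdorff_metric M d B C \<le> 0"
      using BC hyperspaceD(2)[OF BC(1)] by (intro hausdorff_metric_le) (auto intro: mdist_zero[THEN eq_refl])
    then show "hausdorff_metric M d B C = 0" using hausdorff_metric_nonneg[of B C] by simp
  qed
qed (rule hausdorff_metric_triangle)

section \<open>Completeness, total boundedness and closed families in the hyperspace\<close>

lemma (in Metric_space) hyperspace_iff_closedin: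
  assumes "compact_space mtopology"
  shows "B \<in> hyperspace M d \<longleftrightarrow> B \<noteq> {} \<and> closedin mtopology B"
  using assms by (auto simp: hyperspace_def closedin_compact_space
      intro: compactin_imp_closedin[OF Hausdorff_space_mtopology])

text \<open>The limit of a Cauchy sequence \<open>\<sigma>\<close> is the set of cluster points
  \<open>\<Inter>n. cl (\<Union>m\<ge>n. \<sigma> m)\<close>.\<close>

lemma (in Metric_space) mcomplete_hausdorff:
  assumes compact: "compact_space mtopology"
  shows "Metric_space.mcomplete (hyperspace M d) (hausdorff_metric M d)"
proof -
  interpret H: Metric_space "hyperspace M d" "hausdorff_metric M d"
    by (rule Metric_space_hausdorff)
  have "\<exists>B. limitin H.mtopology \<sigma> B sequentially" if "H.MCauchy \<sigma>" for \<sigma>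
  proof -
    have \<sigma>: "\<sigma> n \<in> hyperspace M d" for n using that by (auto simp: H.MCauchy_def)
    have cauchy: "\<exists>N. \<forall>m\<ge>N. \<forall>n\<ge>N. hausdorff_metric M d (\<sigma> m) (\<sigma> n) < e" if "e > 0" for e
      using \<open>H.MCauchy \<sigma>\<close> that by (simp add: H.MCauchy_def)
    define F where "F = (\<lambda>n. mtopology closure_of (\<Union>m\<in>{n..}. \<sigma> m))"
    define B where "B = (\<Inter>n. F n)"
    have sub: "\<sigma> n \<subseteq> M" for n using hyperspaceD(2)[OF \<sigma>] .
    have F_closed: "closedin mtopology (F n)" for n by (simp add: F_def)
    have F_anti: "F n \<subseteq> F m" if "m \<le> n" for m n
      unfolding F_def by (rule closure_of_mono) (use that in force)
    have "F n \<noteq> {}" for n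
    proof -
      have "\<sigma> n \<subseteq> F n"
        unfolding F_def using sub by (intro order_trans[OF _ closure_of_subset]) auto
      then show ?thesis using hyperspaceD(1)[OF \<sigma>[of n]] by blast
    qed
    \<comment> \<open>Cantor's intersection theorem for nested nonempty closed sets.\<close>
    then have "B \<noteq> {}" unfolding B_def
      using compact_space_imp_nest[OF compact F_closed] F_anti by (auto simp: decseq_def)
    moreover have "closedin mtopology B" unfolding B_def using F_closed by blast
    ultimately have B: "B \<in> hyperspace M d" by (simp add: hyperspace_iff_closedin[OF compact])
    have lim: "\<exists>N. \<forall>n\<ge>N. hausdorff_metric M d (\<sigma> n) B < e" if e: "e > 0" for e
    proof -
      \<comment> \<open>Two errors of \<open>e/4\<close> give the bound \<open>e/2\<close> in each
        direction, so the inequality with \<open>e\<close> stays strict after taking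
        suprema.\<close>
      obtain N where N: "\<And>m n. m \<ge> N \<Longrightarrow> n \<ge> N \<Longrightarrow> hausdorff_metric M d (\<sigma> m) (\<sigma> n) < e/4"
        using cauchy[of "e/4"] e by auto
      have "hausdorff_metric M d (\<sigma> n) B \<le> e/2" if n: "n \<ge> N" for n
      proof (rule hausdorff_metric_le[OF \<sigma> B])
        fix x assume x: "x \<in> B"
        then have "x \<in> mtopology closure_of (\<Union>m\<in>{n..}. \<sigma> m)" by (auto simp: B_def F_def)
        then obtain m y where y: "m \<ge> n" "y \<in> \<sigma> m" "x \<in> M" "y \<in> M" "d x y < e/4"
          using e in_mball[of _ x "e/4"] unfolding metric_closure_of mem_Collect_eq
          by (metis UN_E atLeast_iff divide_pos_pos zero_less_numeral)
        obtain z where z: "z \<in> \<sigma> n" "d y z < e/4"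
          using hausdorff_metric_lessD[OF \<sigma> \<sigma> N y(2)] y(1) n by (meson order_trans)
        have "z \<in> M" using z(1) sub by blast
        then have "d x z \<le> e/2" using triangle[of x y z] y z by linarith
        then show "\<exists>z\<in>\<sigma> n. d x z \<le> e/2" using z(1) by blast
      next
        fix y assume y: "y \<in> \<sigma> n"
        \<comment> \<open>Points near \<open>y\<close> are picked in all later sets; a subsequential
          limit lies in every tail closure, hence in \<open>B\<close>, and is still near
          \<open>y\<close>.\<close>
        have "\<exists>z\<in>\<sigma> (n + m). d y z < e/4" for m
          using hausdorff_metric_lessD[OF \<sigma> \<sigma> N y] n by simp
        then obtain z where z: "\<And>m. z m \<in> \<sigma> (n + m)" "\<And>m. d y (z m) < e/4" by metis
        have "range z \<subseteq> M" using z(1) sub by blast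
        then obtain l r where l: "l \<in> M" "strict_mono (r :: nat \<Rightarrow> nat)"
          "limitin mtopology (z \<circ> r) l sequentially"
          using compact unfolding compact_space_sequentially by meson
        have l_lim: "\<exists>K. \<forall>k\<ge>K. d (z (r k)) l < t" if "t > 0" for t
          using l(3) that unfolding limit_metric_sequentially by (metis comp_apply)
        have "l \<in> F m" for m unfolding F_def metric_closure_of
        proof (safe intro!: l(1))
          fix t :: real assume "t > 0"
          then obtain K where K: "\<And>k. k \<ge> K \<Longrightarrow> d (z (r k)) l < t" using l_lim by blast
          \<comment> \<open>Beyond \<open>K\<close> for convergence, and beyond \<open>m\<close> so
            that the point belongs to the tail from \<open>m\<close> on.\<close>
          let ?k = "max K m"
          have "m \<le> n + r ?k" using seq_suble[OF l(2), of ?k] by linarith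
          then have "z (r ?k) \<in> (\<Union>m\<in>{m..}. \<sigma> m)" using z(1) by blast
          moreover have "z (r ?k) \<in> mball l t"
            using K[of ?k] l(1) \<open>range z \<subseteq> M\<close> by (auto simp: commute)
          ultimately show "\<exists>y\<in>\<Union> (\<sigma> ` {m..}). y \<in> mball l t" by blast
        qed
        then have "l \<in> B" by (simp add: B_def)
        moreover obtain K where "d (z (r K)) l < e/4" using l_lim[of "e/4"] e by auto
        then have "d y l \<le> e/2"
          using z(2)[of "r K"] triangle[of y "z (r K)" l] y l(1) sub \<open>range z \<subseteq> M\<close> by force
        ultimately show "\<exists>l\<in>B. d y l \<le> e/2" by blast
      qed
      then show ?thesis using e by (intro exI[of _ N]) force
    qed
    then have "limitin H.mtopology \<sigma> B sequentially"
      using B \<sigma> by (simp add: H.limit_metric_sequentially)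
    then show ?thesis ..
  qed
  then show ?thesis by (simp add: H.mcomplete_def)
qed

text \<open>The nonempty subsets of a finite net of the space form a finite net of the hyperspace;
  with completeness this gives compactness.\<close>

lemma (in Metric_space) compact_space_hyperspace:
  assumes compact: "compact_space mtopology"
  shows "compact_space (hyperspace_topology M d)"
proof -
  interpret H: Metric_space "hyperspace M d" "hausdorff_metric M d"
    by (rule Metric_space_hausdorff)
  have "\<exists>K. finite K \<and> K \<subseteq> hyperspace M d \<and> hyperspace M d \<subseteq> (\<Union>B\<in>K. H.mball B e)"
    if e: "e > 0" for e
  proof -
    obtain K where K: "finite K" "K \<subseteq> M" "M \<subseteq> (\<Union>x\<in>K. mball x (e/2))"
      using compact e by (auto simp: compact_space_eq_mcomplete_mtotally_bounded mtotally_bounded_def)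
        (meson half_gt_zero)
    have net: "\<exists>F\<in>Pow K - {{}}. B \<in> H.mball F e" if B: "B \<in> hyperspace M d" for B
    proof -
      \<comment> \<open>Net points far from \<open>B\<close> are discarded, since every point of
        \<open>F\<close> must itself be close to \<open>B\<close>.\<close>
      define F where "F = {x\<in>K. \<exists>b\<in>B. d x b < e/2}"
      have near: "\<exists>x\<in>F. d x b < e/2" if "b \<in> B" for b
        using K(3) that hyperspaceD(2)[OF B] by (force simp: F_def)
      then have "F \<noteq> {}" using hyperspaceD(1)[OF B] by blast
      moreover have FK: "F \<subseteq> K" by (auto simp: F_def)
      ultimately have F: "F \<in> hyperspace M d"
        using K by (auto simp: hyperspace_def intro!: finite_imp_compactin intro: finite_subset)
      have "hausdorff_metric M d F B \<le> e/2"
      proof (rule hausdorff_metric_le[OF F B])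
        show "\<exists>b\<in>B. d x b \<le> e/2" if "x \<in> F" for x using that by (force simp: F_def)
        show "\<exists>x\<in>F. d b x \<le> e/2" if "b \<in> B" for b using near[OF that] commute by force
      qed
      then show ?thesis using F B FK \<open>F \<noteq> {}\<close> e by (intro bexI[of _ F]) auto
    qed
    have "Pow K - {{}} \<subseteq> hyperspace M d"
      using K by (auto simp: hyperspace_def intro!: finite_imp_compactin intro: finite_subset)
    then show ?thesis using K(1) net by (intro exI[of _ "Pow K - {{}}"]) blast
  qed
  then show ?thesis
    using mcomplete_hausdorff[OF compact]
    by (simp add: H.compact_space_eq_mcomplete_mtotally_bounded H.mtotally_bounded_def)
qed

text \<open>A set not inside \<open>F\<close> has a point with a ball missing \<open>F\<close>, and
  every Hausdorff-close set must meet that ball. Hence the complement is open.\<close>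

lemma (in Metric_space) closedin_hyperspace_subsets:
  assumes "closedin mtopology F"
  shows "closedin (hyperspace_topology M d) {B \<in> hyperspace M d. B \<subseteq> F}"
proof -
  interpret H: Metric_space "hyperspace M d" "hausdorff_metric M d"
    by (rule Metric_space_hausdorff)
  have "\<exists>r>0. disjnt {B \<in> hyperspace M d. B \<subseteq> F} (H.mball B r)"
    if B: "B \<in> hyperspace M d" "\<not> B \<subseteq> F" for B
  proof -
    obtain x where x: "x \<in> B" "x \<notin> F" using B(2) by blast
    moreover have "x \<in> M" using x hyperspaceD(2)[OF B(1)] by blast
    ultimately obtain r where r: "r > 0" "disjnt F (mball x r)"
      using assms unfolding closedin_metric by blast
    have "\<not> C \<subseteq> F" if C: "C \<in> H.mball B r" for C
    proof -
      have CH: "C \<in> hyperspace M d" "hausdorff_metric M d B C < r" using C by auto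
      then obtain y where "y \<in> C" "d x y < r" using hausdorff_metric_lessD[OF B(1) _ _ x(1)] by blast
      moreover have "y \<in> mball x r"
        using calculation \<open>x \<in> M\<close> hyperspaceD(2)[OF CH(1)] by auto
      ultimately show ?thesis using r(2) by (auto simp: disjnt_iff)
    qed
    then show ?thesis using r(1) by (auto simp: disjnt_iff)
  qed
  then show ?thesis by (auto simp: H.closedin_metric)
qed


section \<open>Admissible words and the growth rate\<close>

text \<open>Fekete's lemma: the limit is the infimum of the quotients, finite by nonnegativity. Fix
  \<open>m\<close> with a nearly minimal quotient and divide \<open>n\<close> by \<open>m\<close>:
  the remainder contributes a bounded amount, which vanishes after division by
  \<open>n\<close>.\<close>

lemma subadditive_imp_convergent:
  fixes a :: "nat \<Rightarrow> real"
  assumes subadd: "\<And>m n. a (m + n) \<le> a m + a n" and nonneg: "\<And>n. 0 \<le> a n"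
  shows "convergent (\<lambda>n. a n / real n)"
proof -
  define L where "L = (INF n\<in>{1..}. a n / real n)"
  have bdd: "bdd_below ((\<lambda>n. a n / real n) ` {1..})"
    by (rule bdd_belowI2[of _ 0]) (simp add: nonneg)
  have mult: "a (q * m + r) \<le> real q * a m + a r" for q m r
  proof (induction q)
    case (Suc q)
    have "a (Suc q * m + r) \<le> a m + a (q * m + r)"
      using subadd[of m "q * m + r"] by (simp add: add.assoc)
    then show ?case using Suc by (simp add: algebra_simps)
  qed simp
  have "(\<lambda>n. a n / real n) \<longlonglongrightarrow> L"
  proof (rule LIMSEQ_I)
    fix e :: real assume e: "e > 0"
    have "\<exists>m\<in>{1..}. a m / real m < L + e/2"
      using e by (subst cINF_less_iff[OF _ bdd, symmetric]) (auto simp: L_def)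
    then obtain m where m: "m \<ge> 1" "a m / real m < L + e/2" by auto
    \<comment> \<open>One bound for all remainders \<open>r < m\<close>: each term is at most the
      sum because all terms are nonnegative.\<close>
    define K where "K = (\<Sum>r<m. a r)"
    have "(\<lambda>n. K / real n) \<longlonglongrightarrow> 0" by (rule lim_const_over_n)
    then obtain N where N: "\<And>n. n \<ge> N \<Longrightarrow> \<bar>K / real n\<bar> < e/2"
      using LIMSEQ_D[of _ 0 "e/2"] e by (metis diff_zero half_gt_zero real_norm_def)
    have "norm (a n / real n - L) < e" if n: "n \<ge> max N 1" for n
    proof -
      have lower: "L \<le> a n / real n" unfolding L_def using n by (intro cINF_lower bdd) auto
      have "a n \<le> real (n div m) * a m + a (n mod m)" using mult[of "n div m" m "n mod m"] by simp
      moreover have "a (n mod m) \<le> K" unfolding K_def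
        using m nonneg by (intro member_le_sum) auto
      moreover have "real (n div m) * a m \<le> (real n / real m) * a m"
        using nonneg by (intro mult_right_mono of_nat_div_le_of_nat)
      ultimately have "a n \<le> (real n / real m) * a m + K" by linarith
      then have "a n / real n \<le> a m / real m + K / real n"
        using n m by (simp add: field_simps)
      moreover have "K / real n < e/2" using abs_ge_self[of "K / real n"] N[of n] n by linarith
      ultimately show ?thesis using lower m(2) unfolding real_norm_def by linarith
    qed
    then show "\<exists>N. \<forall>n\<ge>N. norm (a n / real n - L) < e" by blast
  qed
  then show ?thesis by (rule convergentI)
qed

section \<open>Matrix powers and admissible words\<close>

lemma matrix_power_0 [simp]: "matrix_power A 0 = mat 1"
  and matrix_power_Suc: "matrix_power A (Suc n) = A ** matrix_power A n"
  by (simp_all add: matrix_power_def)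

lemma matrix_power_add: "matrix_power A (m + n) = matrix_power A m ** matrix_power A n"
  by (induction m) (simp_all add: matrix_power_Suc matrix_mul_assoc)

text \<open>Each row sum of \<open>C\<close> is at most the sum of all entries, and the weights from
  \<open>B\<close> are nonnegative. This makes the logarithms of the norms of powers
  subadditive.\<close>

lemma matrix_norm_sum_mult_le:
  fixes B C :: "real ^ 'n ^ 'n"
  assumes B: "\<And>i j. 0 \<le> B $ i $ j" and C: "\<And>i j. 0 \<le> C $ i $ j"
  shows "matrix_norm_sum (B ** C) \<le> matrix_norm_sum B * matrix_norm_sum C"
proof -
  have row: "(\<Sum>j\<in>UNIV. C $ k $ j) \<le> matrix_norm_sum C" for k
    unfolding matrix_norm_sum_def
    by (rule member_le_sum[of k UNIV "\<lambda>k. \<Sum>j\<in>UNIV. C $ k $ j"]) (auto intro!: sum_nonneg C)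
  have "(\<Sum>j\<in>UNIV. (B ** C) $ i $ j) = (\<Sum>k\<in>UNIV. B $ i $ k * (\<Sum>j\<in>UNIV. C $ k $ j))" for i
    unfolding matrix_matrix_mult_def by (simp add: sum_distrib_left) (rule sum.swap)
  then have "matrix_norm_sum (B ** C) = (\<Sum>i\<in>UNIV. \<Sum>k\<in>UNIV. B $ i $ k * (\<Sum>j\<in>UNIV. C $ k $ j))"
    by (simp add: matrix_norm_sum_def)
  also have "\<dots> \<le> (\<Sum>i\<in>UNIV. \<Sum>k\<in>UNIV. B $ i $ k * matrix_norm_sum C)"
    by (intro sum_mono mult_left_mono row B)
  finally show ?thesis by (simp add: matrix_norm_sum_def sum_distrib_right)
qed

lemma transition_matrix_nonneg: "transition_matrix A \<Longrightarrow> 0 \<le> A $ i $ j"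
  unfolding transition_matrix_def by (metis insertE order_refl singletonD zero_le_one)

lemma transition_matrix_power_nonneg:
  assumes "transition_matrix A" shows "0 \<le> matrix_power A n $ i $ j"
proof (induction n arbitrary: i j)
  case (Suc n)
  then show ?case using transition_matrix_nonneg[OF assms]
    by (simp add: matrix_power_Suc matrix_matrix_mult_def sum_nonneg)
qed (simp add: mat_def)

text \<open>The parameter \<open>n\<close> counts transitions, so these words have
  \<open>n + 1\<close> letters. Recursion on the first letter mirrors
  \<open>matrix_power_Suc\<close>, which multiplies by \<open>A\<close> on the left.\<close>

primrec words :: "real ^ 'n ^ 'n \<Rightarrow> nat \<Rightarrow> 'n \<Rightarrow> 'n list set" where
  "words A 0 i = {[i]}"
| "words A (Suc n) i = (\<Union>j\<in>{j. A $ i $ j = 1}. (#) i ` words A n j)"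

lemma hd_words: "w \<in> words A n i \<Longrightarrow> w \<noteq> [] \<and> hd w = i"
  by (cases n) auto

lemma finite_words: "finite (words A n i)"
  by (induction n arbitrary: i) auto

text \<open>Words are split by their second letter, which keeps the pieces disjoint. As the entries
  are 0 or 1, summing over allowed successors is summing with weights from row \<open>i\<close> of
  \<open>A\<close>.\<close>

lemma card_words:
  assumes A: "transition_matrix A"
  shows "real (card (words A n i)) = (\<Sum>j\<in>UNIV. matrix_power A n $ i $ j)"
proof (induction n arbitrary: i)
  case (Suc n)
  have "card (words A (Suc n) i) = (\<Sum>j | A $ i $ j = 1. card ((#) i ` words A n j))"
    unfolding words.simps by (intro card_UN_disjoint) (auto simp: finite_words dest: hd_words)
  also have "\<dots> = (\<Sum>j | A $ i $ j = 1. card (words A n j))"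
    by (simp add: card_image)
  finally have "real (card (words A (Suc n) i)) = (\<Sum>j | A $ i $ j = 1. \<Sum>k\<in>UNIV. matrix_power A n $ j $ k)"
    by (simp add: Suc)
  also have "\<dots> = (\<Sum>j\<in>UNIV. A $ i $ j * (\<Sum>k\<in>UNIV. matrix_power A n $ j $ k))"
    using A by (intro sum.mono_neutral_cong_left) (auto simp: transition_matrix_def)
  also have "\<dots> = (\<Sum>k\<in>UNIV. matrix_power A (Suc n) $ i $ k)"
    by (simp add: matrix_power_Suc matrix_matrix_mult_def sum_distrib_left) (rule sum.swap)
  finally show ?case .
qed (simp add: mat_def)

text \<open>Positive row sums give each symbol a successor; a chosen successor function is iterated
  from \<open>i\<close>.\<close>

lemma exists_shift_starting_at:
  assumes A: "transition_matrix A"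
  shows "\<exists>\<alpha>\<in>shift_space A. \<alpha> 0 = i"
proof -
  have "\<exists>j. A $ i $ j = 1" for i
  proof (rule ccontr)
    assume "\<nexists>j. A $ i $ j = 1"
    then have "A $ i $ j = 0" for j using A by (auto simp: transition_matrix_def)
    then have "(\<Sum>j\<in>UNIV. A $ i $ j) = 0" by simp
    moreover have "(\<Sum>j\<in>UNIV. A $ i $ j) \<ge> 1" using A by (simp add: transition_matrix_def)
    ultimately show False by linarith
  qed
  then obtain s where s: "\<And>i. A $ i $ s i = 1" by metis
  show ?thesis by (rule bexI[of _ "\<lambda>k. (s ^^ k) i"]) (auto simp: shift_space_def s)
qed

text \<open>Needed so that the words counted by the matrix really occur in codes. The tail is
  extended to a sequence first, then \<open>i\<close> is prepended.\<close>

lemma words_imp_shift_prefix: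
  assumes A: "transition_matrix A" and "w \<in> words A n i"
  shows "\<exists>\<alpha>\<in>shift_space A. \<alpha> 0 = i \<and> map \<alpha> [0..<Suc n] = w"
  using assms(2)
proof (induction n arbitrary: i w)
  case 0
  then show ?case using exists_shift_starting_at[OF A, of i] by auto
next
  case (Suc n)
  then obtain j v where j: "A $ i $ j = 1" "v \<in> words A n j" "w = i # v" by auto
  obtain \<alpha> where \<alpha>: "\<alpha> \<in> shift_space A" "\<alpha> 0 = j" "map \<alpha> [0..<Suc n] = v" using Suc.IH[OF j(2)] by blast
  let ?\<beta> = "\<lambda>k. case k of 0 \<Rightarrow> i | Suc k \<Rightarrow> \<alpha> k"
  have "?\<beta> \<in> shift_space A" using \<alpha> j by (auto simp: shift_space_def split: nat.split)
  moreover have "map ?\<beta> [0..<Suc (Suc n)] = w"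
  proof -
    have "[0..<Suc (Suc n)] = 0 # map Suc [0..<Suc n]"
      by (simp add: upt_conv_Cons map_Suc_upt del: upt_Suc)
    then show ?thesis using \<alpha>(3) j(3) by (simp add: o_def del: upt_Suc)
  qed
  ultimately show ?case by (intro bexI[of _ ?\<beta>]) auto
qed

text \<open>Row \<open>i\<close> of the power counts the words from \<open>i\<close>, and different
  first letters give different words. Prefixes are one letter longer than the exponent;
  \<open>entropy_C\<close> absorbs this shift.\<close>

lemma matrix_norm_sum_le_card_words:
  assumes A: "transition_matrix A"
  shows "matrix_norm_sum (matrix_power A n) \<le> real (card ((\<lambda>\<alpha>. map \<alpha> [0..<Suc n]) ` shift_space A))"
proof -
  have "matrix_norm_sum (matrix_power A n) = real (\<Sum>i\<in>UNIV. card (words A n i))"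
    by (simp add: matrix_norm_sum_def card_words[OF A])
  also have "(\<Sum>i\<in>UNIV. card (words A n i)) = card (\<Union>i. words A n i)"
    by (subst card_UN_disjoint) (auto simp: finite_words dest: hd_words)
  also have "\<dots> \<le> card ((\<lambda>\<alpha>. map \<alpha> [0..<Suc n]) ` shift_space A)"
  proof (rule card_mono)
    have "(\<lambda>\<alpha>. map \<alpha> [0..<Suc n]) ` shift_space A \<subseteq> {xs. set xs \<subseteq> UNIV \<and> length xs = Suc n}"
      by auto
    then show "finite ((\<lambda>\<alpha>. map \<alpha> [0..<Suc n]) ` shift_space A)"
      by (rule finite_subset) (rule finite_lists_length_eq, simp)
    show "(\<Union>i. words A n i) \<subseteq> (\<lambda>\<alpha>. map \<alpha> [0..<Suc n]) ` shift_space A"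
      using words_imp_shift_prefix[OF A] by blast
  qed
  finally show ?thesis by simp
qed

section \<open>Exponential growth rate of the matrix powers\<close>

lemma matrix_norm_sum_power_ge_1:
  assumes A: "transition_matrix A"
  shows "1 \<le> matrix_norm_sum (matrix_power A n)"
proof -
  have "words A n i \<noteq> {}" for i
  proof (induction n arbitrary: i)
    case (Suc n)
    moreover obtain \<alpha> where "\<alpha> \<in> shift_space A" "\<alpha> 0 = i" using exists_shift_starting_at[OF A] by blast
    then have "A $ i $ \<alpha> 1 = 1" by (auto simp: shift_space_def)
    ultimately show ?case by force
  qed simp
  then have "1 \<le> real (card (words A n i))" for i
    by (simp add: Suc_le_eq card_gt_0_iff finite_words)
  then have "1 \<le> (\<Sum>j\<in>UNIV. matrix_power A n $ i $ j)" for i using card_words[OF A] by metis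
  also have "(\<Sum>j\<in>UNIV. matrix_power A n $ i $ j) \<le> matrix_norm_sum (matrix_power A n)" for i
    unfolding matrix_norm_sum_def
    by (rule member_le_sum[of i UNIV "\<lambda>i. \<Sum>j\<in>UNIV. matrix_power A n $ i $ j"])
      (auto intro!: sum_nonneg transition_matrix_power_nonneg[OF A])
  finally show ?thesis .
qed

text \<open>\<open>matrix_rho\<close> is defined by \<open>lim\<close>, which is informative only
  once convergence is known. Fekete's lemma supplies it for the logarithms, nonnegative because the
  norms are at least 1, and exponentiation transfers it.\<close>

lemma tendsto_ln_matrix_rho:
  assumes A: "transition_matrix A"
  shows "(\<lambda>n. ln (matrix_norm_sum (matrix_power A n)) / real n) \<longlonglongrightarrow> ln (matrix_rho A)"
proof -
  let ?s = "\<lambda>n. matrix_norm_sum (matrix_power A n)"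
  have ge1: "1 \<le> ?s n" for n by (rule matrix_norm_sum_power_ge_1[OF A])
  then have pos: "0 < ?s n" for n by (meson less_le_trans zero_less_one)
  have "ln (?s (m + n)) \<le> ln (?s m) + ln (?s n)" for m n
  proof -
    have "?s (m + n) \<le> ?s m * ?s n" unfolding matrix_power_add
      by (intro matrix_norm_sum_mult_le transition_matrix_power_nonneg A)
    then show ?thesis using pos ln_mult_pos[OF pos pos] by (metis ln_mono)
  qed
  then have "convergent (\<lambda>n. ln (?s n) / real n)" by (rule subadditive_imp_convergent) (simp add: ge1)
  then obtain L where L: "(\<lambda>n. ln (?s n) / real n) \<longlonglongrightarrow> L" by (auto simp: convergent_def)
  \<comment> \<open>At \<open>n = 0\<close> both sides equal 1, as division by zero yields
    0.\<close>
  have "?s n powr (1 / real n) = exp (ln (?s n) / real n)" for n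
    using pos[of n] by (simp add: powr_def)
  then have "(\<lambda>n. ?s n powr (1 / real n)) \<longlonglongrightarrow> exp L" using tendsto_exp[OF L] by simp
  then have "matrix_rho A = exp L" unfolding matrix_rho_def by (rule limI)
  then show ?thesis using L by simp
qed


section \<open>Coding by itineraries\<close>

text \<open>The first \<open>m\<close> terms vanish and the rest is dominated by a geometric
  tail.\<close>

lemma shift_dist_le:
  assumes "\<And>k. k < m \<Longrightarrow> \<alpha> k = \<beta> k"
  shows "shift_dist \<alpha> \<beta> \<le> 2 / 2 ^ m"
proof -
  let ?g = "\<lambda>i. (if \<alpha> i = \<beta> i then 0 else 1) / 2 ^ i :: real"
  have geom: "(\<lambda>i. (1/2) ^ m * (1/2) ^ i :: real) sums ((1/2) ^ m * 2)"
    using geometric_sums[of "1/2::real"] by (intro sums_mult) simp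
  have le: "?g i \<le> (1/2) ^ i" "0 \<le> ?g i" for i by (auto simp: power_one_over)
  have "summable ?g"
    by (rule summable_comparison_test'[of "\<lambda>i. (1/2::real) ^ i" 0]) (use le in auto)
  note sm = summable_ignore_initial_segment[OF this, of m]
    and suminf_split_initial_segment[OF this, of m]
  moreover have "(\<Sum>i<m. ?g i) = 0" using assms by (intro sum.neutral) auto
  moreover have "(\<Sum>i. ?g (i + m)) \<le> (\<Sum>i. (1/2) ^ m * (1/2) ^ i)"
    using le(1)[of "_ + m"] by (intro suminf_le sm sums_summable[OF geom]) (simp add: power_add mult.commute)
  ultimately show ?thesis using sums_unique[OF geom] by (simp add: shift_dist_def power_one_over)
qed

section \<open>Iterates of a non-autonomous system\<close>

lemma iter_from_Suc_shift: "iter_from g i (Suc n) x = iter_from g (Suc i) n (g i x)"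
  by (induction n) auto

lemma iter_from_induced_maps: "iter_from (induced_maps f) i j B = iter_from f i j ` B"
  by (induction j) (auto simp: induced_maps_def)

lemma iter_from_mem:
  assumes "\<And>n. g n \<in> Z \<rightarrow> Z" "x \<in> Z" shows "iter_from g i n x \<in> Z"
  using assms by (induction n) auto

text \<open>The modulus may depend on the number \<open>k\<close> of steps but not on the starting
  time \<open>n\<close>; the codes inherit this uniformity.\<close>

lemma equicontinuous_iter_from:
  assumes g: "\<And>n. g n \<in> Z \<rightarrow> Z" and "equicontinuous_in d d (\<lambda>n. Z) g"
  shows "equicontinuous_in d d (\<lambda>n. Z) (\<lambda>n. iter_from g n k)"
proof (induction k)
  case 0
  then show ?case by (auto simp: equicontinuous_in_def)
next
  case (Suc k)
  show ?case unfolding equicontinuous_in_def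
  proof (intro allI impI)
    fix e :: real assume "e > 0"
    then obtain \<gamma> where \<gamma>: "\<gamma> > 0" "\<And>n x y. x \<in> Z \<Longrightarrow> y \<in> Z \<Longrightarrow> d x y < \<gamma> \<Longrightarrow> d (g n x) (g n y) < e"
      using assms(2) unfolding equicontinuous_in_def by meson
    obtain \<delta> where "\<delta> > 0" "\<And>n x y. x \<in> Z \<Longrightarrow> y \<in> Z \<Longrightarrow> d x y < \<delta> \<Longrightarrow>
        d (iter_from g n k x) (iter_from g n k y) < \<gamma>"
      using Suc \<gamma>(1) unfolding equicontinuous_in_def by meson
    then show "\<exists>\<delta>>0. \<forall>n. \<forall>x\<in>Z. \<forall>y\<in>Z. d x y < \<delta> \<longrightarrow>
        d (iter_from g n (Suc k) x) (iter_from g n (Suc k) y) < e"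
      using \<gamma>(2) iter_from_mem[of g Z, OF g] by (intro exI[of _ \<delta>]) auto
  qed
qed

section \<open>Refined covers and minimal subcovers\<close>

lemma card_image_le_min_subcover_card:
  assumes "finite \<B>" "\<Union>\<B> = Y"
    and const: "\<And>B x y. B \<in> \<B> \<Longrightarrow> x \<in> B \<Longrightarrow> y \<in> B \<Longrightarrow> \<phi> x = \<phi> y"
  shows "card (\<phi> ` Y) \<le> min_subcover_card \<B> Y"
proof -
  \<comment> \<open>Without a finite subcover the \<open>LEAST\<close> would be unspecified.\<close>
  have "\<exists>k. \<exists>\<C>\<subseteq>\<B>. finite \<C> \<and> \<Union>\<C> = Y \<and> card \<C> = k" using assms(1,2) by blast
  then have "\<exists>\<C>\<subseteq>\<B>. finite \<C> \<and> \<Union>\<C> = Y \<and> card \<C> = min_subcover_card \<B> Y"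
    unfolding min_subcover_card_def by (rule LeastI_ex)
  then obtain \<C> where \<C>: "\<C> \<subseteq> \<B>" "finite \<C>" "\<Union>\<C> = Y" "card \<C> = min_subcover_card \<B> Y" by blast
  \<comment> \<open>As \<open>\<phi>\<close> is constant on each element of the subcover, one chosen
    point per element already gives all values.\<close>
  have "\<phi> ` Y \<subseteq> (\<lambda>B. \<phi> (SOME x. x \<in> B)) ` \<C>"
  proof
    fix v assume "v \<in> \<phi> ` Y"
    then obtain B x where B: "B \<in> \<C>" "x \<in> B" "v = \<phi> x" using \<C>(3) by blast
    then have "v = \<phi> (SOME x. x \<in> B)" using const[of B] \<C>(1) someI[of "\<lambda>x. x \<in> B" x] by blast
    then show "v \<in> (\<lambda>B. \<phi> (SOME x. x \<in> B)) ` \<C>" using B(1) by blast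
  qed
  then have "card (\<phi> ` Y) \<le> card \<C>" using \<C>(2) by (rule surj_card_le[rotated])
  then show ?thesis using \<C>(4) by simp
qed

text \<open>Only the choices \<open>U j\<close> with \<open>j < n\<close> matter, so
  \<open>U\<close> may be restricted to \<open>{..<n}\<close>, where finitely many choices
  remain.\<close>

lemma finite_refined_cover:
  assumes "finite \<A>" shows "finite (refined_cover Z g \<A> n)"
proof -
  have "refined_cover Z g \<A> n \<subseteq>
      (\<lambda>U. Z \<inter> (\<Inter>j<n. iter_preimage Z g 0 j (U j))) ` (PiE {..<n} (\<lambda>_. \<A>))"
  proof
    fix R assume "R \<in> refined_cover Z g \<A> n"
    then obtain U where "R = Z \<inter> (\<Inter>j<n. iter_preimage Z g 0 j (U j))" "\<forall>j<n. U j \<in> \<A>"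
      by (auto simp: refined_cover_def)
    then show "R \<in> (\<lambda>U. Z \<inter> (\<Inter>j<n. iter_preimage Z g 0 j (U j))) ` (PiE {..<n} (\<lambda>_. \<A>))"
      by (intro image_eqI[of _ _ "restrict U {..<n}"]) auto
  qed
  then show ?thesis by (rule finite_subset) (intro finite_imageI finite_PiE finite_lessThan assms)
qed

lemma Union_refined_cover:
  assumes g: "\<And>n. g n \<in> Z \<rightarrow> Z" and "\<Union>\<A> = Z"
  shows "\<Union>(refined_cover Z g \<A> n) = Z"
proof
  show "Z \<subseteq> \<Union>(refined_cover Z g \<A> n)"
  proof
    fix z assume z: "z \<in> Z"
    then have "\<forall>j. \<exists>U\<in>\<A>. iter_from g 0 j z \<in> U" using iter_from_mem[of g Z, OF g] assms(2) by blast
    then obtain U where U: "\<And>j. U j \<in> \<A>" "\<And>j. iter_from g 0 j z \<in> U j" by metis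
    then have "z \<in> Z \<inter> (\<Inter>j<n. iter_preimage Z g 0 j (U j))" using z by (auto simp: iter_preimage_def)
    then show "z \<in> \<Union>(refined_cover Z g \<A> n)" using U(1) unfolding refined_cover_def by blast
  qed
qed (auto simp: refined_cover_def)

section \<open>Itinerary sets, codes and the invariant families\<close>

locale itinerary_system = Metric_space X d
  for X :: "'a set" and d :: "'a \<Rightarrow> 'a \<Rightarrow> real" +
  fixes f :: "nat \<Rightarrow> 'a \<Rightarrow> 'a" and A :: "real ^ 'n ^ 'n"
    and V :: "'n \<Rightarrow> nat \<Rightarrow> 'a set" and W :: "'n \<Rightarrow> 'a set"
  assumes compact: "compact_space mtopology"
    and continuous: "\<And>n. continuous_map mtopology mtopology (f n)"
    and equicontinuous: "equicontinuous_in d d (\<lambda>n. X) f"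
    and transition: "transition_matrix A"
    and V_closed: "\<And>i n. closedin mtopology (V i n)"
    and W_closed: "\<And>i. closedin mtopology (W i)"
    and W_disjoint: "\<And>i j. i \<noteq> j \<Longrightarrow> W i \<inter> W j = {}"
    and V_subset_W: "\<And>i n. V i n \<subseteq> W i"
    and itineraries: "\<And>\<alpha> m n. \<alpha> \<in> shift_space A \<Longrightarrow>
           (\<Inter>k\<le>m. iter_preimage X f n k (V (\<alpha> k) (n + k))) \<noteq> {}"
begin

sublocale H: Metric_space "hyperspace X d" "hausdorff_metric X d"
  by (rule Metric_space_hausdorff)

definition itin :: "nat \<Rightarrow> (nat \<Rightarrow> 'n) \<Rightarrow> 'a set" where
  "itin n \<alpha> = (\<Inter>k. iter_preimage X f n k (V (\<alpha> k) (n + k)))"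

definition C :: "nat \<Rightarrow> 'a set set" where
  "C n = {B \<in> hyperspace X d. \<exists>\<alpha>\<in>shift_space A. B \<subseteq> itin n \<alpha>}"

text \<open>On \<open>C n\<close> the choice is unambiguous, by \<open>code_unique\<close>.\<close>

definition code :: "nat \<Rightarrow> 'a set \<Rightarrow> nat \<Rightarrow> 'n" where
  "code n B = (SOME \<alpha>. \<alpha> \<in> shift_space A \<and> B \<subseteq> itin n \<alpha>)"

lemma f_maps: "f n \<in> X \<rightarrow> X"
  using continuous_map_image_subset_topspace[OF continuous, of n] by auto

lemma closedin_iter_preimage: "closedin mtopology S \<Longrightarrow> closedin mtopology (iter_preimage X f n k S)"
proof -
  have "continuous_map mtopology mtopology (iter_from f n k)"
    by (induction k) (auto intro: continuous_map_compose[OF _ continuous] simp: id_def[symmetric] simp del: o_apply)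
  then show "closedin mtopology S \<Longrightarrow> closedin mtopology (iter_preimage X f n k S)"
    by (auto simp: continuous_map_closedin iter_preimage_def)
qed

lemma itinD:
  assumes "x \<in> itin n \<alpha>" shows "x \<in> X" "iter_from f n k x \<in> V (\<alpha> k) (n + k)" "iter_from f n k x \<in> W (\<alpha> k)"
  using assms V_subset_W by (auto simp: itin_def iter_preimage_def)

text \<open>The finite intersections are nonempty by \<open>itineraries\<close>, closed and nested,
  so compactness gives a point that follows the whole sequence.\<close>

lemma itin_hyperspace:
  assumes "\<alpha> \<in> shift_space A" shows "itin n \<alpha> \<in> hyperspace X d"
proof -
  let ?E = "\<lambda>k. iter_preimage X f n k (V (\<alpha> k) (n + k))"
  have "(\<Inter>m. \<Inter>k\<le>m. ?E k) \<noteq> {}"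
    using itineraries[OF assms] closedin_iter_preimage[OF V_closed]
    by (intro compact_space_imp_nest[OF compact]) (auto simp: decseq_def)
  moreover have "(\<Inter>m. \<Inter>k\<le>m. ?E k) = itin n \<alpha>" by (auto simp: itin_def)
  moreover have "closedin mtopology (itin n \<alpha>)"
    unfolding itin_def using closedin_iter_preimage[OF V_closed] by (intro closedin_Inter) auto
  ultimately show ?thesis by (simp add: hyperspace_iff_closedin[OF compact])
qed

lemma itin_in_C: "\<alpha> \<in> shift_space A \<Longrightarrow> itin n \<alpha> \<in> C n"
  using itin_hyperspace by (auto simp: C_def)

text \<open>The orbit of the image from time \<open>Suc n\<close> is the old orbit without its first
  point: stage \<open>Suc k\<close> from \<open>n\<close> is stage \<open>k\<close> from
  \<open>Suc n\<close>.\<close>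

lemma itin_image: "f n ` itin n \<alpha> \<subseteq> itin (Suc n) (shift_map \<alpha>)"
proof
  fix y assume "y \<in> f n ` itin n \<alpha>"
  then obtain x where x: "x \<in> itin n \<alpha>" "y = f n x" by blast
  have "iter_from f (Suc n) k y \<in> V (\<alpha> (Suc k)) (Suc n + k)" for k
    using itinD(2)[OF x(1), of "Suc k"] x(2) unfolding iter_from_Suc_shift by simp
  moreover have "y \<in> X" using x itinD(1) f_maps by blast
  ultimately show "y \<in> itin (Suc n) (shift_map \<alpha>)"
    by (simp add: itin_def iter_preimage_def shift_map_def)
qed

lemma induced_hyperspace: "induced_maps f n \<in> hyperspace X d \<rightarrow> hyperspace X d"
  using image_compactin[OF _ continuous] by (auto simp: induced_maps_def hyperspace_def)

lemma induced_C: "induced_maps f n ` C n \<subseteq> C (Suc n)"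
proof
  fix D assume "D \<in> induced_maps f n ` C n"
  then obtain B \<alpha> where B: "B \<in> hyperspace X d" "\<alpha> \<in> shift_space A" "B \<subseteq> itin n \<alpha>" "D = f n ` B"
    by (auto simp: C_def induced_maps_def)
  then have "D \<subseteq> itin (Suc n) (shift_map \<alpha>)" using itin_image by blast
  moreover have "shift_map \<alpha> \<in> shift_space A" using B(2) by (auto simp: shift_space_def shift_map_def)
  moreover have "D \<in> hyperspace X d" using induced_hyperspace[of n] B by (auto simp: induced_maps_def)
  ultimately show "D \<in> C (Suc n)" by (auto simp: C_def)
qed

lemma code:
  assumes "B \<in> C n" shows "code n B \<in> shift_space A" "B \<subseteq> itin n (code n B)"
  using assms someI_ex[of "\<lambda>\<alpha>. \<alpha> \<in> shift_space A \<and> B \<subseteq> itin n \<alpha>"] by (auto simp: code_def C_def)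

lemma W_unique: "x \<in> W i \<Longrightarrow> x \<in> W j \<Longrightarrow> i = j"
  using W_disjoint by blast

text \<open>A single point of \<open>B\<close> fixes every letter, since its iterate at stage
  \<open>k\<close> lies in only one of the disjoint sets \<open>W i\<close>.\<close>

lemma code_unique:
  assumes "B \<in> C n" "B \<subseteq> itin n \<alpha>" shows "code n B = \<alpha>"
proof
  fix k
  obtain x where "x \<in> B" using assms(1) by (auto simp: C_def hyperspace_def)
  then show "code n B k = \<alpha> k"
    using assms code[OF assms(1)] itinD(3)[of x n _ k] W_unique by blast
qed

text \<open>A union over possibly infinitely many codes does not show closedness. So
  \<open>C n\<close> is rewritten as an intersection over \<open>k\<close> of finite unions of
  closed families, one for each admissible pair of symbols at stages \<open>k\<close> and
  \<open>Suc k\<close>. Pairs rather than single letters record the transitions.\<close>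

lemma closedin_C: "closedin (hyperspace_topology X d) (C n)"
proof -
  let ?E = "\<lambda>k i. iter_preimage X f n k (V i (n + k))"
  let ?G = "\<lambda>k i j. {B \<in> hyperspace X d. B \<subseteq> ?E k i \<inter> ?E (Suc k) j}"
  let ?T = "\<lambda>k. \<Union>p\<in>{p. A $ fst p $ snd p = 1}. ?G k (fst p) (snd p)"
  have "C n = (\<Inter>k. ?T k)"
  proof
    show "C n \<subseteq> (\<Inter>k. ?T k)"
    proof (intro subsetI INT_I)
      fix B k assume "B \<in> C n"
      then obtain \<alpha> where \<alpha>: "B \<in> hyperspace X d" "\<alpha> \<in> shift_space A" "B \<subseteq> itin n \<alpha>"
        by (auto simp: C_def)
      have "A $ \<alpha> k $ \<alpha> (Suc k) = 1" using \<alpha>(2) by (simp add: shift_space_def)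
      moreover have "B \<in> ?G k (\<alpha> k) (\<alpha> (Suc k))" using \<alpha>(1,3) unfolding itin_def by blast
      ultimately show "B \<in> ?T k"
        by (intro UN_I[of "(\<alpha> k, \<alpha> (Suc k))"]) (simp_all only: mem_Collect_eq fst_conv snd_conv)
    qed
    show "(\<Inter>k. ?T k) \<subseteq> C n"
    proof
      fix B assume B: "B \<in> (\<Inter>k. ?T k)"
      have "\<forall>k. \<exists>p. A $ fst p $ snd p = 1 \<and> B \<in> ?G k (fst p) (snd p)"
      proof
        fix k
        have "B \<in> ?T k" using B by (rule INT_D) simp
        then show "\<exists>p. A $ fst p $ snd p = 1 \<and> B \<in> ?G k (fst p) (snd p)"
          by (rule UN_E) (rule exI, erule conjI[OF CollectD])
      qed
      from choice[OF this] obtain p where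
        p: "\<forall>k. A $ fst (p k) $ snd (p k) = 1 \<and> B \<in> ?G k (fst (p k)) (snd (p k))" ..
      define \<alpha> \<beta> where "\<alpha> k = fst (p k)" and "\<beta> k = snd (p k)" for k
      have \<alpha>\<beta>: "A $ \<alpha> k $ \<beta> k = 1" "B \<in> ?G k (\<alpha> k) (\<beta> k)" for k
        using p[THEN spec, of k] by (simp_all only: \<alpha>_def \<beta>_def)
      have BH: "B \<in> hyperspace X d" using \<alpha>\<beta>(2)[of 0] by blast
      then obtain x where x: "x \<in> B" using hyperspaceD(1) by blast
      \<comment> \<open>Consecutive pairs overlap at stage \<open>Suc k\<close>; disjointness of the
        sets \<open>W i\<close>, tested at one point of \<open>B\<close>, glues them into one
        admissible sequence.\<close>
      have "\<beta> k = \<alpha> (Suc k)" for k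
      proof -
        have "x \<in> ?E (Suc k) (\<beta> k)" "x \<in> ?E (Suc k) (\<alpha> (Suc k))"
          using \<alpha>\<beta>(2)[of k] \<alpha>\<beta>(2)[of "Suc k"] x by blast+
        then show ?thesis using V_subset_W W_unique unfolding iter_preimage_def by blast
      qed
      then have "\<alpha> \<in> shift_space A" using \<alpha>\<beta>(1) by (simp add: shift_space_def)
      moreover have "B \<subseteq> itin n \<alpha>" using \<alpha>\<beta>(2) unfolding itin_def by blast
      ultimately show "B \<in> C n" using BH by (auto simp: C_def)
    qed
  qed
  moreover have "closedin (hyperspace_topology X d) (?G k i j)" for k i j
    by (intro closedin_hyperspace_subsets closedin_Int closedin_iter_preimage V_closed)
  then have "closedin (hyperspace_topology X d) (?T k)" for k
    by (intro closedin_Union) (auto intro: finite_subset[OF subset_UNIV])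
  ultimately show ?thesis by auto
qed

lemma C_subset: "C n \<subseteq> (\<Union>i. compact_subsets X d (V i n))"
proof
  fix B assume B: "B \<in> C n"
  have "B \<subseteq> V (code n B 0) n" using code(2)[OF B] itinD(2)[of _ n _ 0] by auto
  then show "B \<in> (\<Union>i. compact_subsets X d (V i n))" using B by (auto simp: C_def compact_subsets_def)
qed

section \<open>Uniform separation and equicontinuity of the codes\<close>

lemma W_separated:
  "\<exists>\<eta>>0. \<forall>i j. \<forall>x\<in>W i. \<forall>y\<in>W j. d x y < \<eta> \<longrightarrow> i = j"
proof -
  \<comment> \<open>Each \<open>?U i\<close> omits every \<open>W j\<close> with \<open>j\<close>
    other than \<open>i\<close>. These sets form an open cover of \<open>X\<close>, and a Lebesgue
    number of it is the required gap.\<close>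
  let ?U = "\<lambda>i. X - (\<Union>j\<in>-{i}. W j)"
  have sub: "W i \<subseteq> X" for i using closedin_subset[OF W_closed[of i]] by simp
  have "x \<in> (\<Union>i. ?U i)" if "x \<in> X" for x
  proof (cases "\<exists>i. x \<in> W i")
    case True
    then obtain i where "x \<in> W i" by blast
    then have "x \<in> ?U i" using that W_unique by blast
    then show ?thesis by blast
  qed (use that in blast)
  moreover have "openin mtopology U" if "U \<in> range ?U" for U
    using that W_closed closedin_topspace[of mtopology]
    by (auto intro!: closedin_Union)
  moreover have "compactin mtopology X" using compact by (simp add: compact_space_def)
  ultimately have "\<exists>\<eta>>0. \<forall>x\<in>X. \<exists>U\<in>range ?U. mball x \<eta> \<subseteq> U"
    by (intro lebesgue_number subsetI) blast+
  then obtain \<eta> where \<eta>: "\<eta> > 0" "\<And>x. x \<in> X \<Longrightarrow> \<exists>U\<in>range ?U. mball x \<eta> \<subseteq> U" by blast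
  have "i = j" if xy: "x \<in> W i" "y \<in> W j" "d x y < \<eta>" for i j x y
  proof -
    have X: "x \<in> X" "y \<in> X" using xy sub by blast+
    then obtain k where "mball x \<eta> \<subseteq> ?U k" using \<eta>(2) by blast
    moreover have "x \<in> mball x \<eta>" "y \<in> mball x \<eta>" using X \<eta>(1) xy(3) by auto
    ultimately have "x \<in> ?U k" "y \<in> ?U k" by blast+
    \<comment> \<open>A point of \<open>W i\<close> in \<open>?U k\<close> forces
      \<open>i = k\<close>, and likewise \<open>j = k\<close>.\<close>
    then show ?thesis using xy by blast
  qed
  then show ?thesis using \<eta>(1) by blast
qed

text \<open>Hausdorff-close sets contain close points, whose first \<open>m\<close> orbit points
  stay within \<open>\<eta>\<close> of each other and so carry the same letters. All bounds are
  uniform in \<open>n\<close>.\<close>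

lemma equicontinuous_code: "equicontinuous_in (hausdorff_metric X d) shift_dist C code"
  unfolding equicontinuous_in_def
proof (intro allI impI)
  fix e :: real assume e: "e > 0"
  obtain m where m: "2 / 2 ^ m < e"
    using real_arch_pow_inv[of "e/2" "1/2"] e by (auto simp: field_simps)
  obtain \<eta> where \<eta>: "\<eta> > 0" "\<And>i j x y. x \<in> W i \<Longrightarrow> y \<in> W j \<Longrightarrow> d x y < \<eta> \<Longrightarrow> i = j"
    using W_separated by metis
  have "\<exists>\<delta>>0. \<forall>n. \<forall>x\<in>X. \<forall>y\<in>X. d x y < \<delta> \<longrightarrow> d (iter_from f n k x) (iter_from f n k y) < \<eta>" for k
    using equicontinuous_iter_from[OF f_maps equicontinuous, of k] \<eta>(1)
    unfolding equicontinuous_in_def by blast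
  then obtain \<delta> where \<delta>: "\<And>k. \<delta> k > 0"
    "\<And>k n x y. x \<in> X \<Longrightarrow> y \<in> X \<Longrightarrow> d x y < \<delta> k \<Longrightarrow> d (iter_from f n k x) (iter_from f n k y) < \<eta>"
    by metis
  \<comment> \<open>The element 1 keeps the set nonempty when \<open>m = 0\<close>.\<close>
  define \<delta>' where "\<delta>' = Min (insert 1 (\<delta> ` {..<m}))"
  have "\<delta>' > 0" unfolding \<delta>'_def using \<delta>(1) by auto
  moreover have "shift_dist (code n B) (code n B') < e"
    if B: "B \<in> C n" "B' \<in> C n" "hausdorff_metric X d B B' < \<delta>'" for n B B'
  proof -
    have BH: "B \<in> hyperspace X d" "B' \<in> hyperspace X d" using B by (auto simp: C_def)
    then obtain x where x: "x \<in> B" using hyperspaceD(1) by blast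
    obtain y where y: "y \<in> B'" "d x y < \<delta>'" using hausdorff_metric_lessD[OF BH B(3) x] by blast
    have it: "x \<in> itin n (code n B)" "y \<in> itin n (code n B')" using code(2) B x y by blast+
    have "code n B k = code n B' k" if "k < m" for k
    proof -
      have "d x y < \<delta> k" using y(2) that unfolding \<delta>'_def by auto
      then have "d (iter_from f n k x) (iter_from f n k y) < \<eta>" using \<delta>(2) itinD(1) it by blast
      then show ?thesis using \<eta>(2) itinD(3)[of _ n _ k] it by blast
    qed
    then have "shift_dist (code n B) (code n B') \<le> 2 / 2 ^ m" by (rule shift_dist_le)
    then show ?thesis using m by linarith
  qed
  ultimately show "\<exists>\<delta>>0. \<forall>n. \<forall>x\<in>C n. \<forall>y\<in>C n.
      hausdorff_metric X d x y < \<delta> \<longrightarrow> shift_dist (code n x) (code n y) < e" by blast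
qed

lemma code_image: "code n ` C n = shift_space A"
proof
  show "shift_space A \<subseteq> code n ` C n"
    using code_unique[OF itin_in_C order_refl] itin_in_C by (metis image_eqI subsetI)
qed (use code(1) in blast)

lemma code_induced:
  assumes "B \<in> C n" shows "code (Suc n) (induced_maps f n B) = shift_map (code n B)"
proof (rule code_unique)
  show "induced_maps f n B \<in> C (Suc n)" using assms induced_C by blast
  show "induced_maps f n B \<subseteq> itin (Suc n) (shift_map (code n B))"
    using code(2)[OF assms] itin_image[of n "code n B"] unfolding induced_maps_def by blast
qed

section \<open>The entropy bound\<close>

lemma entropy_C: "ereal (ln (matrix_rho A)) \<le> top_entropy (hyperspace_topology X d) (induced_maps f) (C 0)"
proof -
  obtain \<eta> where \<eta>: "\<eta> > 0" "\<And>i j x y. x \<in> W i \<Longrightarrow> y \<in> W j \<Longrightarrow> d x y < \<eta> \<Longrightarrow> i = j"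
    using W_separated by metis
  obtain K where K: "finite K" "K \<subseteq> hyperspace X d" "hyperspace X d \<subseteq> (\<Union>B\<in>K. H.mball B (\<eta>/2))"
    using compact_space_hyperspace[OF compact] \<eta>(1) half_gt_zero
    unfolding H.compact_space_eq_mcomplete_mtotally_bounded H.mtotally_bounded_def by meson
  \<comment> \<open>Radius \<open>\<eta>/2\<close>, so that two members of one ball are less than
    \<open>\<eta>\<close> apart.\<close>
  define \<A> where "\<A> = (\<lambda>B. H.mball B (\<eta>/2)) ` K"
  have \<A>: "finite \<A>" "\<Union>\<A> = hyperspace X d"
    using K H.mball_subset_mspace by (auto simp: \<A>_def)
  have open_\<A>: "open_cover (hyperspace_topology X d) \<A>"
    unfolding open_cover_def using \<A>(2) by (auto simp: \<A>_def)
  let ?R = "\<lambda>n. restrict_cover (refined_cover (hyperspace X d) (induced_maps f) \<A> n) (C 0)"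
  have "card ((\<lambda>B. map (code 0 B) [0..<n]) ` C 0) \<le> min_subcover_card (?R n) (C 0)" for n
  proof (rule card_image_le_min_subcover_card)
    show "finite (?R n)" unfolding restrict_cover_def by (intro finite_imageI finite_refined_cover \<A>)
    have "\<Union>(?R n) = \<Union>(refined_cover (hyperspace X d) (induced_maps f) \<A> n) \<inter> C 0"
      by (auto simp: restrict_cover_def)
    also have "\<dots> = C 0"
      unfolding Union_refined_cover[OF induced_hyperspace \<A>(2)] by (auto simp: C_def)
    finally show "\<Union>(?R n) = C 0" .
    fix R B B' assume R: "R \<in> ?R n" "B \<in> R" "B' \<in> R"
    then have B: "B \<in> C 0" "B' \<in> C 0" by (auto simp: restrict_cover_def)
    obtain U where U: "\<forall>j<n. U j \<in> \<A>"
      and "R = (hyperspace X d \<inter> (\<Inter>j<n. iter_preimage (hyperspace X d) (induced_maps f) 0 j (U j))) \<inter> C 0"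
      using R(1) unfolding restrict_cover_def refined_cover_def by auto
    then have RU: "iter_from f 0 j ` D \<in> U j" if "D \<in> R" "j < n" for D j
      using that by (auto simp: iter_preimage_def iter_from_induced_maps)
    have "code 0 B j = code 0 B' j" if j: "j < n" for j
    proof -
      let ?B = "iter_from f 0 j ` B" and ?B' = "iter_from f 0 j ` B'"
      obtain D where "U j = H.mball D (\<eta>/2)" using U j by (auto simp: \<A>_def)
      then have D: "D \<in> hyperspace X d" "?B \<in> hyperspace X d" "?B' \<in> hyperspace X d"
        "hausdorff_metric X d D ?B < \<eta>/2" "hausdorff_metric X d D ?B' < \<eta>/2"
        using RU[OF R(2) j] RU[OF R(3) j] by auto
      then have lt: "hausdorff_metric X d ?B ?B' < \<eta>"
        using H.triangle''[OF D(2) D(1) D(3)] by linarith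
      \<comment> \<open>The Hausdorff estimate compares the images at time \<open>j\<close>, so the
        point found near the iterate of \<open>x\<close> is itself the iterate of some
        \<open>y\<close> in \<open>B'\<close>; by the choice of \<open>\<eta>\<close> both carry the
        same letter.\<close>
      obtain x where x: "x \<in> B" using D(2) hyperspaceD(1) by blast
      then obtain y where y: "y \<in> B'" "d (iter_from f 0 j x) (iter_from f 0 j y) < \<eta>"
        using hausdorff_metric_lessD[OF D(2,3) lt] by blast
      show ?thesis using \<eta>(2)[OF _ _ y(2)] itinD(3)[of _ 0 _ j] x y(1) code(2) B by blast
    qed
    then show "map (code 0 B) [0..<n] = map (code 0 B') [0..<n]" by simp
  qed
  moreover have "(\<lambda>B. map (code 0 B) [0..<n]) ` C 0 = (\<lambda>\<alpha>. map \<alpha> [0..<n]) ` shift_space A" for n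
    unfolding code_image[of 0, symmetric] image_image ..
  ultimately have card: "matrix_norm_sum (matrix_power A n) \<le> real (min_subcover_card (?R (Suc n)) (C 0))" for n
    using matrix_norm_sum_le_card_words[OF transition, of n] by (metis of_nat_mono order_trans)
  let ?s = "\<lambda>n. matrix_norm_sum (matrix_power A n)"
  let ?a = "\<lambda>n. 1 / real n * ln (real (min_subcover_card (?R n) (C 0)))"
  \<comment> \<open>The power \<open>n\<close> counts words of length \<open>Suc n\<close>, so the
    normalisation by \<open>n\<close> is changed to \<open>Suc n\<close>; the ratio tends to 1.
    Cancelling \<open>n\<close> needs \<open>n\<close> at least 1, hence the passage to eventual
    equality.\<close>
  have "(\<lambda>n. real n / real (Suc n) * (ln (?s n) / real n)) \<longlonglongrightarrow> 1 * ln (matrix_rho A)"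
    by (intro tendsto_mult LIMSEQ_n_over_Suc_n tendsto_ln_matrix_rho transition)
  then have "(\<lambda>n. ln (?s n) / real (Suc n)) \<longlonglongrightarrow> ln (matrix_rho A)"
    unfolding mult_1
    by (rule Lim_transform_eventually) (rule eventually_sequentiallyI[of 1], simp del: of_nat_Suc)
  \<comment> \<open>Reindexed so that the refinement of order \<open>n\<close> meets the power
    \<open>n - 1\<close>.\<close>
  then have "(\<lambda>n. ln (?s (n - 1)) / real n) \<longlonglongrightarrow> ln (matrix_rho A)"
    using filterlim_sequentially_Suc[of "\<lambda>n. ln (?s (n - 1)) / real n"] by simp
  then have "ereal (ln (matrix_rho A)) = limsup (\<lambda>n. ereal (ln (?s (n - 1)) / real n))"
    by (intro lim_imp_Limsup[symmetric]) auto
  also have "\<dots> \<le> limsup (\<lambda>n. ereal (?a n))"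
  proof (rule Limsup_mono, rule eventually_sequentiallyI)
    fix n :: nat assume "1 \<le> n"
    moreover have "0 < ?s (n - 1)"
      using matrix_norm_sum_power_ge_1[OF transition] by (meson less_le_trans zero_less_one)
    ultimately have "ln (?s (n - 1)) \<le> ln (real (min_subcover_card (?R n) (C 0)))"
      using card[of "n - 1"] by (intro ln_mono) auto
    then show "ereal (ln (?s (n - 1)) / real n) \<le> ereal (?a n)"
      by (simp add: divide_right_mono)
  qed
  \<comment> \<open>Entropy is a supremum over covers, so this single cover suffices.\<close>
  also have "\<dots> \<le> top_entropy (hyperspace_topology X d) (induced_maps f) (C 0)"
    unfolding top_entropy_def by (rule SUP_upper2[of \<A>]) (use open_\<A> in auto)
  finally show ?thesis .
qed

end

section \<open>Assembly of the semiconjugacy and the entropy bound\<close>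

theorem theorem4p4:
  fixes X :: "'a set" and d :: "'a \<Rightarrow> 'a \<Rightarrow> real"
    and f :: "nat \<Rightarrow> 'a \<Rightarrow> 'a"
    and A :: "real ^ 'n ^ 'n"
    and V :: "'n \<Rightarrow> nat \<Rightarrow> 'a set" and W :: "'n \<Rightarrow> 'a set"
  assumes metric: "Metric_space X d"
    and compact: "compact_space (Metric_space.mtopology X d)"
    and continuous: "\<And>n. continuous_map (Metric_space.mtopology X d) (Metric_space.mtopology X d) (f n)"
    and equicontinuous: "equicontinuous_in d d (\<lambda>n. X) f"
    and transition: "transition_matrix A"
    and V_closed: "\<And>i n. closedin (Metric_space.mtopology X d) (V i n)"
    and V_nonempty: "\<And>i n. V i n \<noteq> {}"
    and W_closed: "\<And>i. closedin (Metric_space.mtopology X d) (W i)"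
    and W_disjoint: "\<And>i j. i \<noteq> j \<Longrightarrow> W i \<inter> W j = {}"
    and V_subset_W: "\<And>i n. V i n \<subseteq> W i"
    and itineraries: "\<And>\<alpha> m n. \<alpha> \<in> shift_space A \<Longrightarrow>
           (\<Inter>k\<le>m. iter_preimage X f n k (V (\<alpha> k) (n + k))) \<noteq> {}"
  shows "\<exists>C :: nat \<Rightarrow> 'a set set.
           (\<forall>n. C n \<noteq> {} \<and>
                compactin (hyperspace_topology X d) (C n) \<and>
                C n \<subseteq> (\<Union>i. compact_subsets X d (V i n)) \<and>
                induced_maps f n ` C n \<subseteq> C (Suc n)) \<and>
           equi_semiconjugate (hausdorff_metric X d) C (induced_maps f)
             shift_dist (shift_space A) shift_map \<and>
           top_entropy (hyperspace_topology X d) (induced_maps f) (C 0) \<ge> ereal (ln (matrix_rho A))"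
proof -
  interpret Metric_space X d by (rule metric)
  interpret itinerary_system X d f A V W
    by unfold_locales (fact compact continuous equicontinuous transition V_closed W_closed
        W_disjoint V_subset_W itineraries)+
  have "C n \<noteq> {}" for n using exists_shift_starting_at[OF transition] itin_in_C by blast
  moreover have "compactin (hyperspace_topology X d) (C n)" for n
    using closedin_compact_space[OF compact_space_hyperspace[OF compact] closedin_C] .
  moreover have "equi_semiconjugate (hausdorff_metric X d) C (induced_maps f)
      shift_dist (shift_space A) shift_map"
    unfolding equi_semiconjugate_def using code_image equicontinuous_code code_induced by blast
  ultimately show ?thesis using C_subset induced_C entropy_C by (intro exI[of _ C] conjI allI)
qed

end
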